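(* Consider the Pareto model with parameter set $\Theta=(0,\infty)$, let $k>0$ be fixed and let $\gamma\in[1,\infty)$. Let $(\beta_N)_{N\ge1}$ be a sequence of tail probabilities in $(0,1)$ with $\beta_N^{-1}=O(1)$ as $N\to\infty$. Then the DR-Value at Risk $(\mathcal{E}^{k,\gamma}_{\mathcal{Q}|\mathbf{x}_N}\circ \mathrm{VaR}_{\beta_N})(X)$ is regularizable.
   Context: Pareto model: $X, X_1,X_2,\dots$ are real random variables and $\mathcal{Q}=\{Q_\theta:\theta\in\Theta\}$ is the family of measures under which they are iid with density $f(x;\theta)=\theta x^{-(1+\theta)}$ for $x>1$. Here $\Theta=(0,\infty)$. Write $\mathbf{x}_N=(X_1,\dots,X_N)$, $\ell(\mathbf{x}_N;\theta)=\sum_{i=1}^N\log f(X_i;\theta)$, and define the divergence $\alpha_{\mathcal{Q}|\mathbf{x}_N}(\theta)=\sup_{\theta'\in\Theta}\ell(\mathbf{x}_N;\theta')-\ell(\mathbf{x}_N;\theta)$. For $\delta\in\mathbb{R}$, the $\delta$-truncation is $\alpha^{(\delta)}_{\mathcal{Q}|\mathbf{x}_N}(\theta)=\alpha_{\mathcal{Q}|\mathbf{x}_N}(\theta)$ if $\alpha_{\mathcal{Q}|\mathbf{x}_N}(\theta)\le N^\delta$ and $+\infty$ otherwise. For a risk assessment $\mathcal{R}$ (a map from laws on $\mathbb{R}$ to values in $(-\infty,\infty]$), write $\mathcal{R}_\theta$ for its value on the law of $X$ under $Q_\theta$. For $k>0$ and $\gamma\in[1,\infty)$, put $$(\mathcal{E}^{k,\gamma,\delta}_{\mathcal{Q}|\mathbf{x}_N}\circ\mathcal{R})(X)=\sup_{\theta\in\Theta}\Big\{\mathcal{R}_\theta-\Big(\tfrac1k\alpha^{(\delta)}_{\mathcal{Q}|\mathbf{x}_N}(\theta)\Big)^\gamma\Big\},$$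 where parameters with infinite penalty are excluded from the supremum. This quantity is called regular (for given observations $\mathbf{x}_N$) if the supremum is finite and attained at a point $\theta$ with $\alpha_{\mathcal{Q}|\mathbf{x}_N}(\theta)<N^\delta$. For a sequence $(\mathcal{R}_N)$ of risk assessments, $(\mathcal{E}^{k,\gamma}_{\mathcal{Q}|\mathbf{x}_N}\circ\mathcal{R}_N)(X)$ is called regularizable if there exists $\delta>0$ such that, for every $P\in\mathcal{Q}$, with $P$-probability tending to $1$ as $N\to\infty$, $(\mathcal{E}^{k,\gamma,\delta}_{\mathcal{Q}|\mathbf{x}_N}\circ\mathcal{R}_N)(X)$ is regular. The Value at Risk with tail probability $\beta\in(0,1)$ under $Q_\theta$ is $\mathrm{VaR}_\beta(X)=F_\theta^{-1}(1-\beta)=\beta^{-1/\theta}$, where $F_\theta$ is the cdf of $X$ under $Q_\theta$. *)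

theory Defs
  imports "HOL-Probability.Probability" "HOL-Library.Landau_Symbols"
begin

definition pareto_params :: "real set" where
  "pareto_params = {0<..}"

definition pareto_density :: "real \<Rightarrow> real \<Rightarrow> real" where
  "pareto_density \<theta> x = (if x > 1 then \<theta> * x powr (- (1 + \<theta>)) else 0)"

(* M only supplies the underlying measurable space; its measure plays no role.
   X 0 is the risk under assessment, X 1, X 2, ... are the observations. *)
locale pareto_model =
  fixes M :: "'a measure"
    and Q :: "real \<Rightarrow> 'a measure"
    and X :: "nat \<Rightarrow> 'a \<Rightarrow> real"
  assumes sets_Q: "\<theta> \<in> pareto_params \<Longrightarrow> sets (Q \<theta>) = sets M"
    and prob_space_Q: "\<theta> \<in> pareto_params \<Longrightarrow> prob_space (Q \<theta>)"
    and indep_X: "\<theta> \<in> pareto_params \<Longrightarrow> prob_space.indep_vars (Q \<theta>) (\<lambda>_. borel) X UNIV"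
    and density_X: "\<theta> \<in> pareto_params \<Longrightarrow>
      distributed (Q \<theta>) lborel (X i) (\<lambda>x. ennreal (pareto_density \<theta> x))"

(* The convention log 0 = -\<infinity>, as opposed to ln 0 = 0. *)
definition log_density :: "real \<Rightarrow> real \<Rightarrow> ereal" where
  "log_density \<theta> x =
     (if pareto_density \<theta> x > 0 then ereal (ln (pareto_density \<theta> x)) else - \<infinity>)"

definition log_likelihood :: "nat \<Rightarrow> (nat \<Rightarrow> real) \<Rightarrow> real \<Rightarrow> ereal" where
  "log_likelihood N x \<theta> = (\<Sum>i=1..N. log_density \<theta> (x i))"

(* If some observation is at most 1 (a null event under every Q \<theta>), both terms
   are -\<infinity> and ereal subtraction makes the divergence \<infinity> for every \<theta>. *)
definition divergence :: "nat \<Rightarrow> (nat \<Rightarrow> real) \<Rightarrow> real \<Rightarrow> ereal" where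
  "divergence N x \<theta> =
     (SUP \<theta>'\<in>pareto_params. log_likelihood N x \<theta>') - log_likelihood N x \<theta>"

definition truncated_divergence :: "real \<Rightarrow> nat \<Rightarrow> (nat \<Rightarrow> real) \<Rightarrow> real \<Rightarrow> ereal" where
  "truncated_divergence \<delta> N x \<theta> =
     (if divergence N x \<theta> \<le> ereal (real N powr \<delta>) then divergence N x \<theta> else \<infinity>)"

(* Only used where the truncated divergence is finite (it is then nonnegative). *)
definition penalty :: "real \<Rightarrow> real \<Rightarrow> real \<Rightarrow> nat \<Rightarrow> (nat \<Rightarrow> real) \<Rightarrow> real \<Rightarrow> real" where
  "penalty k \<gamma> \<delta> N x \<theta> = (real_of_ereal (truncated_divergence \<delta> N x \<theta>) / k) powr \<gamma>"

(* r \<theta> is the value of the risk assessment at the law of X 0 under Q \<theta>. *)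
definition dr_value ::
  "real \<Rightarrow> real \<Rightarrow> real \<Rightarrow> nat \<Rightarrow> (nat \<Rightarrow> real) \<Rightarrow> (real \<Rightarrow> ereal) \<Rightarrow> ereal" where
  "dr_value k \<gamma> \<delta> N x r =
     (SUP \<theta>\<in>{\<theta> \<in> pareto_params. truncated_divergence \<delta> N x \<theta> < \<infinity>}.
        r \<theta> - ereal (penalty k \<gamma> \<delta> N x \<theta>))"

definition dr_regular ::
  "real \<Rightarrow> real \<Rightarrow> real \<Rightarrow> nat \<Rightarrow> (nat \<Rightarrow> real) \<Rightarrow> (real \<Rightarrow> ereal) \<Rightarrow> bool" where
  "dr_regular k \<gamma> \<delta> N x r \<longleftrightarrow>
     \<bar>dr_value k \<gamma> \<delta> N x r\<bar> \<noteq> \<infinity> \<and>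
     (\<exists>\<theta>\<in>pareto_params. divergence N x \<theta> < ereal (real N powr \<delta>) \<and>
        r \<theta> - ereal (penalty k \<gamma> \<delta> N x \<theta>) = dr_value k \<gamma> \<delta> N x r)"

context pareto_model
begin

definition risk_under :: "(real measure \<Rightarrow> ereal) \<Rightarrow> real \<Rightarrow> ereal" where
  "risk_under R \<theta> = R (distr (Q \<theta>) borel (X 0))"

(* A non-measurable event would have measure 0, so the limit also asserts that
   the event of regularity is measurable for all large N. *)
definition regularizable :: "real \<Rightarrow> real \<Rightarrow> (nat \<Rightarrow> real measure \<Rightarrow> ereal) \<Rightarrow> bool" where
  "regularizable k \<gamma> R \<longleftrightarrow>
     (\<exists>\<delta>>0. \<forall>\<theta>\<^sub>0\<in>pareto_params.
        (\<lambda>N. measure (Q \<theta>\<^sub>0)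
           {\<omega> \<in> space M. dr_regular k \<gamma> \<delta> N (\<lambda>i. X i \<omega>) (risk_under (R N))})
        \<longlonglongrightarrow> 1)"

end

(* \<beta> is the tail probability, so this is the lower (1 - \<beta>)-quantile. *)
definition VaR :: "real \<Rightarrow> real measure \<Rightarrow> ereal" where
  "VaR \<beta> \<mu> = ereal (Inf {x. cdf \<mu> x \<ge> 1 - \<beta>})"

end

theory Submission
  imports Defs "HOL-Real_Asymp.Real_Asymp"
begin

text \<open>Take \<open>\<delta> = 1\<close>. With \<open>S = \<Sum>i=1..N. ln (X\<^sub>i)\<close> and \<open>u = \<theta> S / N\<close> the divergence is
  \<open>N (u - 1 - ln u)\<close>, so the truncation confines \<open>u\<close> to a fixed compact subset of \<open>(0, \<infinity>)\<close>, on
  which \<open>u \<ge> exp (-2)\<close>. The objective becomes \<open>exp (c / u)\<close> minus the penalty, where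
  \<open>c = - ln \<beta>\<^sub>N S / N\<close>. On the boundary the penalty is \<open>(N / k) powr \<gamma>\<close>, while
  \<open>exp (c / u) \<le> exp (c exp 2)\<close>; so the maximum is interior as soon as \<open>S / N\<close> is at most a
  multiple of \<open>ln (N / k)\<close>, and the probability of the contrary tends to \<open>0\<close> by Markov's
  inequality. Regularity for some \<open>c\<close> implies regularity for all smaller \<open>c\<close>, which makes the
  event of regularity measurable.\<close>

section \<open>Elementary bounds for \<open>u - 1 - ln u\<close>\<close>

definition scaled_divergence :: "real \<Rightarrow> real" where
  "scaled_divergence u = u - 1 - ln u"

lemma scaled_divergence_1 [simp]: "scaled_divergence 1 = 0"
  by (simp add: scaled_divergence_def)

lemma scaled_divergence_nonneg: "u > 0 \<Longrightarrow> scaled_divergence u \<ge> 0"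
  using ln_le_minus_one[of u] by (simp add: scaled_divergence_def)

text \<open>Dropping the positive summand \<open>u\<close> leaves \<open>-1 - ln u \<le> 1\<close>;
  this is the source of the constant \<open>exp (-2)\<close>.\<close>

lemma scaled_divergence_le_1_lower:
  assumes "u > 0" "scaled_divergence u \<le> 1"
  shows "exp (-2) \<le> u"
proof -
  have "-2 \<le> ln u" using assms by (simp add: scaled_divergence_def)
  thus ?thesis using assms(1) by (metis exp_le_cancel_iff exp_ln)
qed

text \<open>The tangent of \<open>ln\<close> at \<open>2\<close>, with \<open>ln 2 \<le> 1\<close>,
  gives \<open>ln u \<le> u / 2\<close>, so that \<open>u / 2 - 1 \<le> 1\<close>.\<close>

lemma scaled_divergence_le_1_upper:
  assumes "u > 0" "scaled_divergence u \<le> 1"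
  shows "u \<le> 4"
proof -
  have "ln (u / 2) \<le> u / 2 - 1" using assms by (intro ln_le_minus_one) auto
  moreover have "ln (u / 2) = ln u - ln 2" using assms by (simp add: ln_div)
  moreover have "ln (2::real) \<le> 1" using ln_le_minus_one[of "2::real"] by simp
  ultimately show ?thesis using assms(2) by (simp add: scaled_divergence_def)
qed

text \<open>No derivative is taken: the claim amounts to \<open>ln (u / w) \<le> u - w\<close>,
  which follows from \<open>ln y \<le> y - 1\<close> at \<open>y = u / w\<close> because dividing
  \<open>w - u\<close> by \<open>w \<le> 1\<close> does not decrease it.\<close>

lemma scaled_divergence_antimono:
  assumes "0 < u" "u \<le> w" "w \<le> 1"
  shows "scaled_divergence w \<le> scaled_divergence u"
proof -
  have "ln (u / w) \<le> u / w - 1" using assms by (intro ln_le_minus_one) auto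
  moreover have "ln (u / w) = ln u - ln w" using assms by (simp add: ln_div)
  moreover have "u / w - 1 \<le> u - w"
  proof -
    have "(w - u) * 1 \<le> (w - u) * (1 / w)"
      using assms by (intro mult_left_mono) (auto simp: field_simps)
    thus ?thesis using assms by (simp add: field_simps)
  qed
  ultimately show ?thesis by (simp add: scaled_divergence_def)
qed

section \<open>Interior maximisers of the rescaled objective\<close>

definition objective :: "real \<Rightarrow> real \<Rightarrow> nat \<Rightarrow> real \<Rightarrow> real \<Rightarrow> real" where
  "objective k \<gamma> N c u = exp (c / u) - (real N * scaled_divergence u / k) powr \<gamma>"

text \<open>Regularity for \<open>\<delta> = 1\<close> in the coordinate \<open>u\<close>, with the
  truncation level \<open>N\<close> divided out. The observations enter only through the single
  number \<open>c\<close>.\<close>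

definition interior_max :: "real \<Rightarrow> real \<Rightarrow> nat \<Rightarrow> real \<Rightarrow> bool" where
  "interior_max k \<gamma> N c \<longleftrightarrow>
     (\<exists>u>0. scaled_divergence u < 1 \<and>
        (\<forall>v>0. scaled_divergence v \<le> 1 \<longrightarrow> objective k \<gamma> N c v \<le> objective k \<gamma> N c u))"

text \<open>The bounds \<open>exp (-2)\<close> and \<open>4\<close> place the whole feasible set
  inside an interval away from \<open>0\<close>, where \<open>scaled_divergence\<close> is
  continuous; so this set is compact.\<close>

lemma objective_attains_max:
  assumes "k > 0" "\<gamma> \<ge> 1"
  obtains w where "w > 0" "scaled_divergence w \<le> 1"
    "\<And>v. v > 0 \<Longrightarrow> scaled_divergence v \<le> 1 \<Longrightarrow> objective k \<gamma> N c v \<le> objective k \<gamma> N c w"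
proof -
  define I where "I = {exp (-2) .. 4::real}"
  define K where "K = I \<inter> scaled_divergence -` {..1}"
  have pos: "u > 0" if "u \<in> I" for u
    using that less_le_trans[OF exp_gt_zero[of "-2::real"]] by (auto simp: I_def)
  have cont: "continuous_on I scaled_divergence"
    unfolding scaled_divergence_def[abs_def] by (intro continuous_intros) (use pos in force)
  have "closed K"
    unfolding K_def using cont by (rule continuous_closed_preimage) (auto simp: I_def)
  moreover have "bounded K"
    by (rule bounded_subset[of I]) (auto simp: K_def I_def)
  ultimately have "compact K" by (simp add: compact_eq_bounded_closed)
  moreover have K_iff: "u \<in> K \<longleftrightarrow> u > 0 \<and> scaled_divergence u \<le> 1" for u
    using pos[of u] scaled_divergence_le_1_lower[of u] scaled_divergence_le_1_upper[of u]
    unfolding K_def I_def Int_iff vimage_eq atMost_iff atLeastAtMost_iff by blast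
  moreover have "1 \<in> K" by (simp add: K_iff)
  moreover have "continuous_on K (objective k \<gamma> N c)"
  proof -
    have "continuous_on K scaled_divergence"
      by (rule continuous_on_subset[OF cont]) (simp add: K_def)
    \<comment> \<open>The base of the power vanishes at \<open>u = 1\<close>; continuity there holds
      because the base is nonnegative and the exponent positive.\<close>
    moreover have "0 \<le> real N * scaled_divergence u / k" if "u \<in> K" for u
      using that assms(1) K_iff[of u] scaled_divergence_nonneg[of u] by simp
    moreover have "u \<noteq> 0" if "u \<in> K" for u using that K_iff[of u] by simp
    ultimately show ?thesis
      unfolding objective_def[abs_def] using assms
      by (intro continuous_on_diff continuous_on_exp continuous_on_powr' continuous_on_divide
          continuous_on_mult continuous_on_const continuous_on_id) auto
  qed
  ultimately obtain w where "w \<in> K" "\<forall>v\<in>K. objective k \<gamma> N c v \<le> objective k \<gamma> N c w"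
    using continuous_attains_sup[of K "objective k \<gamma> N c"] by blast
  thus thesis using that K_iff by blast
qed

text \<open>A maximiser on the boundary to the right of \<open>1\<close> can be replaced by \<open>1\<close> itself, as both terms
  of the objective decrease there.\<close>

lemma interior_maxI:
  assumes "k > 0" "\<gamma> \<ge> 1" "c \<ge> 0" "u > 0" "scaled_divergence u < 1"
    and left: "\<And>w. 0 < w \<Longrightarrow> w < 1 \<Longrightarrow> scaled_divergence w = 1 \<Longrightarrow>
      objective k \<gamma> N c w \<le> objective k \<gamma> N c u"
  shows "interior_max k \<gamma> N c"
proof -
  obtain w where w: "w > 0" "scaled_divergence w \<le> 1"
    "\<And>v. v > 0 \<Longrightarrow> scaled_divergence v \<le> 1 \<Longrightarrow> objective k \<gamma> N c v \<le> objective k \<gamma> N c w"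
    using objective_attains_max[OF assms(1,2)] by metis
  \<comment> \<open>A strictly feasible point that does at least as well as the maximiser
    \<open>w\<close> is itself a maximiser.\<close>
  have *: "interior_max k \<gamma> N c"
    if "u > 0" "scaled_divergence u < 1" "objective k \<gamma> N c w \<le> objective k \<gamma> N c u" for u
    unfolding interior_max_def using that w(3) by (meson order_trans)
  consider "scaled_divergence w < 1" | "scaled_divergence w = 1" "w < 1" | "w \<ge> 1"
    using w(2) by linarith
  thus ?thesis
  proof cases
    case 1
    thus ?thesis using *[of w] w by simp
  next
    case 2
    thus ?thesis using *[of u] left[of w] w assms by simp
  next
    case 3
    hence "c / w \<le> c" using assms(3) by (simp add: divide_le_eq mult_left_le_one_le mult_le_cancel_left1)
    hence "exp (c / w) \<le> exp c" by simp
    moreover have "(real N * scaled_divergence w / k) powr \<gamma> \<ge> 0" by simp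
    \<comment> \<open>The penalty at \<open>1\<close> is \<open>0 powr \<gamma>\<close>, which is
      \<open>0\<close>.\<close>
    moreover have "objective k \<gamma> N c 1 = exp c" by (simp add: objective_def)
    ultimately have "objective k \<gamma> N c w \<le> objective k \<gamma> N c 1"
      unfolding objective_def[of k \<gamma> N c w] by linarith
    thus ?thesis by (intro *[of 1]) simp_all
  qed
qed

text \<open>Let \<open>u\<close> be an interior maximiser for \<open>c\<close>. Only boundary points
  \<open>w\<close> left of \<open>1\<close> can compete with it for \<open>c'\<close>, and the
  advantage \<open>exp (x / w) - exp (x / u)\<close> of such a \<open>w\<close> over
  \<open>u\<close> increases with \<open>x \<ge> 0\<close>, while the penalties do not depend on
  \<open>x\<close>.\<close>

lemma interior_max_antimono:
  assumes "k > 0" "\<gamma> \<ge> 1" "0 \<le> c'" "c' \<le> c" "interior_max k \<gamma> N c"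
  shows "interior_max k \<gamma> N c'"
proof -
  obtain u where u: "u > 0" "scaled_divergence u < 1"
    "\<And>v. v > 0 \<Longrightarrow> scaled_divergence v \<le> 1 \<Longrightarrow> objective k \<gamma> N c v \<le> objective k \<gamma> N c u"
    using assms(5) by (auto simp: interior_max_def)
  show ?thesis
  proof (rule interior_maxI[OF assms(1,2,3) u(1,2)])
    fix w :: real assume w: "0 < w" "w < 1" "scaled_divergence w = 1"
    \<comment> \<open>Otherwise \<open>u \<le> w < 1\<close>, and antitonicity would force
      \<open>scaled_divergence u \<ge> 1\<close>.\<close>
    have "w < u" using scaled_divergence_antimono[of u w] u w by fastforce
    \<comment> \<open>Written as a product of two factors that are nonnegative and increasing for
      \<open>x \<ge> 0\<close>, the difference is visibly monotone in \<open>x\<close>.\<close>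
    have shift: "exp (x / w) - exp (x / u) = exp (x / u) * (exp (x * (1 / w - 1 / u)) - 1)" for x
      by (simp add: algebra_simps flip: exp_add)
    have d: "0 \<le> 1 / w - 1 / u" using \<open>w < u\<close> w by (simp add: field_simps)
    have "exp (c' / w) - exp (c' / u) \<le> exp (c / w) - exp (c / u)"
      unfolding shift using d assms(3,4) u(1)
      by (intro mult_mono) (auto intro!: divide_right_mono mult_right_mono mult_nonneg_nonneg)
    thus "objective k \<gamma> N c' w \<le> objective k \<gamma> N c' u"
      using u(3)[of w] w by (simp add: objective_def)
  qed
qed

text \<open>On the left boundary the penalty is exactly \<open>(N / k) powr \<gamma>\<close> and
  outweighs \<open>exp (c / w)\<close>, so the objective is at most \<open>0\<close>; the competitor
  \<open>u = 1\<close> pays no penalty and has a positive value.\<close>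

lemma interior_max_of_exp_le:
  assumes "k > 0" "\<gamma> \<ge> 1" "c \<ge> 0" "exp (c * exp 2) \<le> (real N / k) powr \<gamma>"
  shows "interior_max k \<gamma> N c"
proof (rule interior_maxI[OF assms(1,2,3), of 1])
  fix w :: real assume w: "0 < w" "w < 1" "scaled_divergence w = 1"
  have "exp (-2) \<le> w" using w by (intro scaled_divergence_le_1_lower) auto
  hence "1 / w \<le> exp 2" using w by (simp add: exp_minus field_simps)
  hence "c * (1 / w) \<le> c * exp 2" using assms(3) by (rule mult_left_mono)
  hence "exp (c / w) \<le> exp (c * exp 2)" by simp
  with assms(4) have "exp (c / w) \<le> (real N / k) powr \<gamma>" by linarith
  hence "objective k \<gamma> N c w \<le> 0" using w by (simp add: objective_def)
  also have "0 \<le> objective k \<gamma> N c 1" by (simp add: objective_def)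
  finally show "objective k \<gamma> N c w \<le> objective k \<gamma> N c 1" .
qed auto

section \<open>Divergence and regularity for fixed observations\<close>

lemma log_likelihood_eq:
  assumes "\<And>i. i \<in> {1..N} \<Longrightarrow> x i > 1" "\<theta> > 0"
  shows "log_likelihood N x \<theta> = ereal (real N * ln \<theta> - (1 + \<theta>) * (\<Sum>i=1..N. ln (x i)))"
proof -
  have "log_density \<theta> (x i) = ereal (ln \<theta> - (1 + \<theta>) * ln (x i))" if "i \<in> {1..N}" for i
  proof -
    have "x i > 1" using assms(1)[OF that] .
    thus ?thesis using assms(2)
      by (auto simp: log_density_def pareto_density_def ln_mult algebra_simps)
  qed
  hence "log_likelihood N x \<theta> = (\<Sum>i=1..N. ereal (ln \<theta> - (1 + \<theta>) * ln (x i)))"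
    unfolding log_likelihood_def by (intro sum.cong) auto
  thus ?thesis by (simp add: sum_subtractf sum_distrib_left)
qed

text \<open>The likelihood is maximal at \<open>N / S\<close>, so \<open>\<theta> * S / N\<close> is
  the ratio of \<open>\<theta>\<close> to the maximum likelihood estimate. The value is
  \<open>N\<close> times the Kullback-Leibler divergence of the exponential law of rate
  \<open>\<theta>\<close> from that of rate \<open>N / S\<close>.\<close>

lemma divergence_eq:
  fixes N :: nat and x :: "nat \<Rightarrow> real"
  defines "S \<equiv> \<Sum>i=1..N. ln (x i)"
  assumes x: "\<And>i. i \<in> {1..N} \<Longrightarrow> x i > 1" and "N \<ge> 1" "\<theta> > 0"
  shows "S > 0" "divergence N x \<theta> = ereal (real N * scaled_divergence (\<theta> * S / real N))"
proof -
  show S: "S > 0" unfolding S_def using \<open>N \<ge> 1\<close> by (intro sum_pos ln_gt_zero x) auto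
  have ll: "log_likelihood N x t = ereal (real N * ln t - (1 + t) * S)" if "t > 0" for t
    unfolding S_def using x that by (rule log_likelihood_eq)
  \<comment> \<open>The log-likelihood at \<open>N / S\<close>. The identity \<open>gap\<close> then
    serves twice: its sign shows that \<open>L\<close> is an upper bound, and its value is the
    divergence.\<close>
  define L where "L = real N * ln (real N / S) - (real N + S)"
  have gap: "L - (real N * ln t - (1 + t) * S) = real N * scaled_divergence (t * S / real N)"
    if "t > 0" for t
    using that S \<open>N \<ge> 1\<close> by (simp add: L_def scaled_divergence_def ln_mult ln_div field_simps)
  have "(SUP t\<in>pareto_params. log_likelihood N x t) = ereal L"
  proof (rule SUP_eqI)
    fix t assume "t \<in> pareto_params"
    hence "t > 0" by (simp add: pareto_params_def)
    moreover have "0 \<le> real N * scaled_divergence (t * S / real N)"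
      using \<open>t > 0\<close> S \<open>N \<ge> 1\<close> by (intro mult_nonneg_nonneg scaled_divergence_nonneg) auto
    ultimately show "log_likelihood N x t \<le> ereal L" using gap[of t] by (simp add: ll)
  next
    fix y assume y: "\<And>t. t \<in> pareto_params \<Longrightarrow> log_likelihood N x t \<le> y"
    have "log_likelihood N x (real N / S) = ereal L"
      using S \<open>N \<ge> 1\<close> by (simp add: ll L_def field_simps)
    thus "ereal L \<le> y" using y[of "real N / S"] S \<open>N \<ge> 1\<close> by (simp add: pareto_params_def)
  qed
  thus "divergence N x \<theta> = ereal (real N * scaled_divergence (\<theta> * S / real N))"
    using gap[OF \<open>\<theta> > 0\<close>] \<open>\<theta> > 0\<close> by (simp add: divergence_def ll)
qed

lemma divergence_eq_infinity:
  assumes "i \<in> {1..N}" "x i \<le> 1"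
  shows "divergence N x \<theta> = \<infinity>"
proof -
  have "log_likelihood N x t = -\<infinity>" for t
  proof -
    have "log_density t (x i) = -\<infinity>"
      using assms(2) by (simp add: log_density_def pareto_density_def)
    \<comment> \<open>In \<open>ereal\<close> the sum of \<open>\<infinity>\<close> and
      \<open>-\<infinity>\<close> is \<open>\<infinity>\<close>, so the remaining summands must be
      kept away from \<open>\<infinity>\<close>.\<close>
    moreover have "(\<Sum>j\<in>{1..N} - {i}. log_density t (x j)) \<noteq> \<infinity>"
      by (simp add: sum_Pinfty log_density_def)
    ultimately show ?thesis
      using assms(1) by (simp add: log_likelihood_def sum.remove[of _ i])
  qed
  thus ?thesis by (simp add: divergence_def pareto_params_def)
qed

text \<open>The substitution \<open>u = \<theta> * S / N\<close> is a bijection of the positive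
  reals that takes the truncated parameter set to the feasible set and \<open>b / \<theta>\<close>
  to \<open>c / u\<close>. Finiteness of the supremum comes with attainment, as the objective is
  real-valued.\<close>

lemma dr_regular_iff:
  fixes N :: nat and x :: "nat \<Rightarrow> real"
  defines "S \<equiv> \<Sum>i=1..N. ln (x i)"
  assumes x: "\<And>i. i \<in> {1..N} \<Longrightarrow> x i > 1" and "N \<ge> 1"
    and r: "\<And>\<theta>. \<theta> > 0 \<Longrightarrow> r \<theta> = ereal (exp (b / \<theta>))"
  shows "dr_regular k \<gamma> 1 N x r \<longleftrightarrow> interior_max k \<gamma> N (b * S / real N)"
proof -
  define c where "c = b * S / real N"
  define u where "u = (\<lambda>\<theta>. \<theta> * S / real N)"
  have S: "S > 0" unfolding S_def using x \<open>N \<ge> 1\<close> zero_less_one by (rule divergence_eq(1))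
  have upos: "u \<theta> > 0" if "\<theta> > 0" for \<theta> using that S \<open>N \<ge> 1\<close> by (simp add: u_def)
  have div: "divergence N x \<theta> = ereal (real N * scaled_divergence (u \<theta>))" if "\<theta> > 0" for \<theta>
    unfolding S_def u_def using x \<open>N \<ge> 1\<close> that by (rule divergence_eq(2))
  have inv: "real N * v / S > 0" "u (real N * v / S) = v" if "v > 0" for v
    using that S \<open>N \<ge> 1\<close> by (simp_all add: u_def)
  have trunc: "truncated_divergence 1 N x \<theta> =
      (if scaled_divergence (u \<theta>) \<le> 1 then ereal (real N * scaled_divergence (u \<theta>)) else \<infinity>)"
    if "\<theta> > 0" for \<theta>
    using that \<open>N \<ge> 1\<close> by (simp add: truncated_divergence_def div)
  define T where "T = {\<theta>. \<theta> > 0 \<and> scaled_divergence (u \<theta>) \<le> 1}"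
  have T: "{\<theta> \<in> pareto_params. truncated_divergence 1 N x \<theta> < \<infinity>} = T"
    by (auto simp: T_def pareto_params_def trunc split: if_splits)
  have obj: "r \<theta> - ereal (penalty k \<gamma> 1 N x \<theta>) = ereal (objective k \<gamma> N c (u \<theta>))" if "\<theta> \<in> T" for \<theta>
  proof -
    have "c / u \<theta> = b / \<theta>" using that S \<open>N \<ge> 1\<close> by (simp add: T_def c_def u_def)
    thus ?thesis using that by (simp add: T_def r penalty_def trunc objective_def)
  qed
  have val: "dr_value k \<gamma> 1 N x r = (SUP \<theta>\<in>T. ereal (objective k \<gamma> N c (u \<theta>)))"
    unfolding dr_value_def T using obj by (intro SUP_cong) auto
  have "dr_regular k \<gamma> 1 N x r \<longleftrightarrow> interior_max k \<gamma> N c"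
  proof
    assume "dr_regular k \<gamma> 1 N x r"
    then obtain \<theta> where t: "\<theta> > 0" "scaled_divergence (u \<theta>) < 1"
      "r \<theta> - ereal (penalty k \<gamma> 1 N x \<theta>) = dr_value k \<gamma> 1 N x r"
      using \<open>N \<ge> 1\<close> by (auto simp: dr_regular_def pareto_params_def div)
    have eq: "(SUP \<theta>\<in>T. ereal (objective k \<gamma> N c (u \<theta>))) = ereal (objective k \<gamma> N c (u \<theta>))"
      using t obj[of \<theta>] val by (simp add: T_def)
    have "objective k \<gamma> N c v \<le> objective k \<gamma> N c (u \<theta>)"
      if "v > 0" "scaled_divergence v \<le> 1" for v
    proof -
      have "real N * v / S \<in> T" unfolding T_def using that inv by auto
      hence "ereal (objective k \<gamma> N c (u (real N * v / S))) \<le> ereal (objective k \<gamma> N c (u \<theta>))"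
        unfolding eq[symmetric] by (rule SUP_upper)
      thus ?thesis using inv(2)[OF that(1)] by simp
    qed
    thus "interior_max k \<gamma> N c" using t upos by (auto simp: interior_max_def)
  next
    assume "interior_max k \<gamma> N c"
    then obtain v where v: "v > 0" "scaled_divergence v < 1"
      "\<And>w. w > 0 \<Longrightarrow> scaled_divergence w \<le> 1 \<Longrightarrow> objective k \<gamma> N c w \<le> objective k \<gamma> N c v"
      by (auto simp: interior_max_def)
    define \<theta> where "\<theta> = real N * v / S"
    have t: "\<theta> > 0" "u \<theta> = v" using inv[OF v(1)] by (auto simp: \<theta>_def)
    hence tT: "\<theta> \<in> T" using v by (simp add: T_def)
    have eq: "dr_value k \<gamma> 1 N x r = ereal (objective k \<gamma> N c v)"
      unfolding val
    proof (rule SUP_eqI)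
      fix t' assume "t' \<in> T"
      thus "ereal (objective k \<gamma> N c (u t')) \<le> ereal (objective k \<gamma> N c v)"
        using v(3)[of "u t'"] upos by (simp add: T_def)
    next
      fix y assume "\<And>i. i \<in> T \<Longrightarrow> ereal (objective k \<gamma> N c (u i)) \<le> y"
      from this[OF tT] show "ereal (objective k \<gamma> N c v) \<le> y" using t by simp
    qed
    have "divergence N x \<theta> < ereal (real N powr 1)" using t v \<open>N \<ge> 1\<close> by (simp add: div)
    thus "dr_regular k \<gamma> 1 N x r"
      unfolding dr_regular_def using eq obj[OF tT] t
      by (auto simp: pareto_params_def intro!: bexI[of _ \<theta>])
  qed
  thus ?thesis by (simp add: c_def)
qed

lemma not_dr_regular:
  assumes "i \<in> {1..N}" "x i \<le> 1"
  shows "\<not> dr_regular k \<gamma> \<delta> N x r"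
  using divergence_eq_infinity[where x = x, OF assms] by (auto simp: dr_regular_def)

section \<open>The Pareto law: distribution function, Value at Risk and logarithmic mean\<close>

context pareto_model
begin

lemma cdf_X:
  assumes "\<theta> > 0"
  shows "cdf (distr (Q \<theta>) borel (X i)) x = (if x \<ge> 1 then 1 - x powr (-\<theta>) else 0)"
proof -
  have t: "\<theta> \<in> pareto_params" using assms by (simp add: pareto_params_def)
  interpret prob_space "Q \<theta>" by (rule prob_space_Q[OF t])
  have exponent: "- (1 + \<theta>) = -\<theta> - 1" by simp
  note D = density_X[OF t, of i]
  have [measurable]: "X i \<in> borel_measurable (Q \<theta>)" using distributed_measurable[OF D] by simp
  have "cdf (distr (Q \<theta>) borel (X i)) x = prob (X i -` {..x} \<inter> space (Q \<theta>))"
    by (simp add: cdf_def measure_distr)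
  moreover have "emeasure (Q \<theta>) (X i -` {..x} \<inter> space (Q \<theta>)) =
      (\<integral>\<^sup>+y. ennreal (pareto_density \<theta> y) * indicator {..x} y \<partial>lborel)"
    by (rule distributed_emeasure[OF D]) simp
  \<comment> \<open>The integrands differ at most at \<open>y = 1\<close>, where the density is
    \<open>0\<close> by definition but the power formula is not; hence the congruence holds only
    almost everywhere.\<close>
  moreover have "\<dots> = (\<integral>\<^sup>+y. ennreal (\<theta> * y powr (- (1 + \<theta>))) * indicator {1..x} y \<partial>lborel)"
    by (rule nn_integral_cong_AE, use AE_lborel_singleton[of 1] in eventually_elim)
       (auto simp: pareto_density_def indicator_def)
  moreover have "\<dots> = ennreal (if x \<ge> 1 then 1 - x powr (-\<theta>) else 0)"
  proof (cases "x \<ge> 1")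
    case True
    have "(\<integral>\<^sup>+y. ennreal (\<theta> * y powr (- (1 + \<theta>))) * indicator {1..x} y \<partial>lborel) =
        ennreal (- (x powr (-\<theta>)) - - (1 powr (-\<theta>)))"
    proof (rule nn_integral_FTC_Icc[OF _ _ _ True])
      fix y :: real assume "y \<in> {1..x}"
      hence y: "1 \<le> y" "y \<le> x" by auto
      show "((\<lambda>y. - (y powr (-\<theta>))) has_real_derivative \<theta> * y powr (- (1 + \<theta>))) (at y)"
        unfolding exponent using DERIV_minus[OF has_real_derivative_powr[of y "-\<theta>"]] y by simp
    qed (use assms in auto)
    thus ?thesis using True by simp
  next
    case False
    thus ?thesis by simp
  qed
  moreover have "(if x \<ge> 1 then 1 - x powr (-\<theta>) else 0) \<ge> (0::real)"
    using assms by (auto intro!: powr_le1 simp: powr_minus field_simps ge_one_powr_ge_zero)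
  ultimately show ?thesis by (simp add: measure_def split: if_splits)
qed

text \<open>The superlevel set of the distribution function is a closed half-line, so its infimum is
  the end point. The exponential form of \<open>p powr (-1 / \<theta>)\<close> is the one that
  \<open>dr_regular_iff\<close> expects, with \<open>b = - ln p\<close>.\<close>

lemma risk_under_VaR:
  assumes "\<theta> > 0" "0 < p" "p < 1"
  shows "risk_under (VaR p) \<theta> = ereal (exp (- ln p / \<theta>))"
proof -
  have "cdf (distr (Q \<theta>) borel (X 0)) x \<ge> 1 - p \<longleftrightarrow> exp (- ln p / \<theta>) \<le> x" for x
  proof (cases "x \<ge> 1")
    case True
    have "x powr (-\<theta>) \<le> p \<longleftrightarrow> ln (x powr (-\<theta>)) \<le> ln p"
      using True assms by (subst ln_le_cancel_iff) auto
    also have "\<dots> \<longleftrightarrow> -\<theta> * ln x \<le> ln p" by simp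
    also have "\<dots> \<longleftrightarrow> - ln p / \<theta> \<le> ln x"
      unfolding pos_divide_le_eq[OF assms(1)] mult.commute[of "ln x"] by linarith
    also have "\<dots> \<longleftrightarrow> exp (- ln p / \<theta>) \<le> x" using True by (intro ln_ge_iff) auto
    finally show ?thesis using True assms by (simp add: cdf_X)
  next
    case False
    have "1 \<le> exp (- ln p / \<theta>)" using assms by (simp add: divide_nonpos_pos)
    hence "\<not> exp (- ln p / \<theta>) \<le> x" using False by linarith
    moreover have "\<not> cdf (distr (Q \<theta>) borel (X 0)) x \<ge> 1 - p"
      using False assms by (simp add: cdf_X)
    ultimately show ?thesis by blast
  qed
  hence "{x. cdf (distr (Q \<theta>) borel (X 0)) x \<ge> 1 - p} = {exp (- ln p / \<theta>)..}" by auto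
  thus ?thesis by (simp add: risk_under_def VaR_def)
qed

lemma nn_integral_ln_X:
  assumes "\<theta> > 0"
  shows "(\<integral>\<^sup>+\<omega>. ennreal (ln (X i \<omega>)) \<partial>Q \<theta>) = ennreal (1 / \<theta>)"
proof -
  have t: "\<theta> \<in> pareto_params" using assms by (simp add: pareto_params_def)
  have exponent: "- (1 + \<theta>) = -\<theta> - 1" by simp
  \<comment> \<open>An antiderivative of \<open>\<theta> * y powr (- (1 + \<theta>)) * ln y\<close>,
    found by integration by parts; it tends to \<open>0\<close> at infinity and equals
    \<open>-1 / \<theta>\<close> at \<open>1\<close>.\<close>
  define F where "F = (\<lambda>y. - (y powr (-\<theta>) * (ln y + 1 / \<theta>)))"
  have "(\<integral>\<^sup>+\<omega>. ennreal (ln (X i \<omega>)) \<partial>Q \<theta>) =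
      (\<integral>\<^sup>+y. ennreal (pareto_density \<theta> y) * ennreal (ln y) \<partial>lborel)"
    by (rule distributed_nn_integral[OF density_X[OF t], symmetric]) simp
  \<comment> \<open>Here the integrands agree even at \<open>y = 1\<close>, because
    \<open>ln 1 = 0\<close>.\<close>
  also have "\<dots> = (\<integral>\<^sup>+y. ennreal (\<theta> * y powr (- (1 + \<theta>)) * ln y) * indicator {1..} y \<partial>lborel)"
    using assms by (intro nn_integral_cong)
      (auto simp: pareto_density_def indicator_def ennreal_mult' not_less)
  also have "\<dots> = ennreal (0 - F 1)"
  proof (rule nn_integral_FTC_atLeast)
    show "DERIV F y :> \<theta> * y powr (- (1 + \<theta>)) * ln y" if "1 \<le> y" for y
    proof -
      have "y powr (-\<theta>) = y powr (- (1 + \<theta>)) * y powr 1"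
        by (subst powr_add[symmetric]) simp
      hence eq: "inverse y * y powr (-\<theta>) = y powr (- (1 + \<theta>))" using that by simp
      have "DERIV (\<lambda>y. y powr (-\<theta>)) y :> -\<theta> * y powr (- (1 + \<theta>))"
        unfolding exponent using has_real_derivative_powr[of y "-\<theta>"] that by simp
      moreover have "DERIV (\<lambda>y. ln y + 1 / \<theta>) y :> inverse y"
        using DERIV_add[OF DERIV_ln DERIV_const] that by fastforce
      ultimately have "DERIV F y :> - (-\<theta> * y powr (- (1 + \<theta>)) * (ln y + 1 / \<theta>)
          + inverse y * y powr (-\<theta>))"
        unfolding F_def by (intro DERIV_minus DERIV_mult)
      also have "- (-\<theta> * y powr (- (1 + \<theta>)) * (ln y + 1 / \<theta>) + inverse y * y powr (-\<theta>)) =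
          \<theta> * y powr (- (1 + \<theta>)) * ln y"
        unfolding eq using assms by (simp add: algebra_simps)
      finally show ?thesis .
    qed
    show "(F \<longlongrightarrow> 0) at_top" unfolding F_def using assms by real_asymp
  qed (use assms in auto)
  finally show ?thesis by (simp add: F_def)
qed

lemma AE_X_gt_1:
  assumes "\<theta> > 0"
  shows "AE \<omega> in Q \<theta>. X i \<omega> > 1"
proof -
  have t: "\<theta> \<in> pareto_params" using assms by (simp add: pareto_params_def)
  interpret prob_space "Q \<theta>" by (rule prob_space_Q[OF t])
  have [measurable]: "X i \<in> borel_measurable (Q \<theta>)"
    using distributed_measurable[OF density_X[OF t, of i]] by simp
  have "prob (X i -` {..1} \<inter> space (Q \<theta>)) = 0"
    using cdf_X[OF assms, of i 1] by (simp add: cdf_def measure_distr)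
  hence "X i -` {..1} \<inter> space (Q \<theta>) \<in> null_sets (Q \<theta>)"
    by (simp add: null_sets_def emeasure_eq_measure)
  thus ?thesis by (rule AE_I') auto
qed

section \<open>Probability of regularity\<close>

lemma prob_sum_ln_X_gt:
  assumes "\<theta> > 0" "t > 0" "N \<ge> 1"
  shows "measure (Q \<theta>) {\<omega> \<in> space (Q \<theta>). (\<forall>i\<in>{1..N}. X i \<omega> > 1) \<and>
      (\<Sum>i=1..N. ln (X i \<omega>)) > real N * t} \<le> 1 / (\<theta> * t)"
    (is "measure _ ?B \<le> _")
proof -
  have p: "\<theta> \<in> pareto_params" using assms by (simp add: pareto_params_def)
  interpret prob_space "Q \<theta>" by (rule prob_space_Q[OF p])
  have [measurable]: "X i \<in> borel_measurable (Q \<theta>)" for i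
    using distributed_measurable[OF density_X[OF p, of i]] by simp
  define u where "u = (\<lambda>\<omega>. \<Sum>i=1..N. ennreal (ln (X i \<omega>)))"
  \<comment> \<open>This factor turns the threshold \<open>N * t\<close> into the \<open>1\<close>
    of Markov's inequality.\<close>
  define d where "d = ennreal (1 / (real N * t))"
  have [measurable]: "u \<in> borel_measurable (Q \<theta>)" unfolding u_def by measurable
  have "?B \<subseteq> {\<omega> \<in> space (Q \<theta>). 1 \<le> d * u \<omega>}"
  proof safe
    fix \<omega> assume w: "\<forall>i\<in>{1..N}. X i \<omega> > 1" "(\<Sum>i=1..N. ln (X i \<omega>)) > real N * t"
    \<comment> \<open>Observations above \<open>1\<close> have positive logarithms, so
      \<open>ennreal\<close> cuts nothing off and commutes with the sum.\<close>
    have "u \<omega> = ennreal (\<Sum>i=1..N. ln (X i \<omega>))"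
      unfolding u_def using w(1) by (intro sum_ennreal) (auto simp: less_imp_le)
    hence "d * u \<omega> = ennreal (1 / (real N * t) * (\<Sum>i=1..N. ln (X i \<omega>)))"
      unfolding d_def using assms by (subst ennreal_mult'[where b = "sum _ _"]) simp_all
    moreover have "1 \<le> 1 / (real N * t) * (\<Sum>i=1..N. ln (X i \<omega>))"
      using w(2) assms by (simp add: field_simps)
    ultimately show "1 \<le> d * u \<omega>" by simp
  qed
  hence "emeasure (Q \<theta>) ?B \<le> emeasure (Q \<theta>) {\<omega> \<in> space (Q \<theta>). 1 \<le> d * u \<omega>}"
    by (rule emeasure_mono) measurable
  also have "\<dots> \<le> d * (\<integral>\<^sup>+\<omega>. u \<omega> \<partial>Q \<theta>)"
    using nn_integral_Markov_inequality[where u = u and M = "Q \<theta>" and A = "space (Q \<theta>)" and c = d]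
    by (simp add: nn_set_integral_space)
  also have "(\<integral>\<^sup>+\<omega>. u \<omega> \<partial>Q \<theta>) = ennreal (real N / \<theta>)"
  proof -
    have "(\<integral>\<^sup>+\<omega>. u \<omega> \<partial>Q \<theta>) = (\<Sum>i=1..N. ennreal (1 / \<theta>))"
      unfolding u_def by (subst nn_integral_sum) (simp_all only: nn_integral_ln_X[OF assms(1)], measurable)
    also have "\<dots> = ennreal (\<Sum>i=1..N. 1 / \<theta>)" using assms(1) by (intro sum_ennreal) simp
    finally show ?thesis by simp
  qed
  also have "d * ennreal (real N / \<theta>) = ennreal (1 / (\<theta> * t))"
    unfolding d_def using assms by (subst ennreal_mult'[symmetric]) (auto simp: field_simps)
  finally show ?thesis using assms by (simp add: emeasure_eq_measure)
qed

text \<open>Almost surely all observations exceed \<open>1\<close>. Outside the Markov event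
  \<open>B\<close> one then has \<open>c \<le> - ln p * t\<close>, and \<open>bound\<close> makes
  \<open>interior_max_of_exp_le\<close> applicable.\<close>

lemma prob_regular_ge:
  assumes "\<theta> > 0" "t > 0" "N \<ge> 1" "k > 0" "\<gamma> \<ge> 1" "0 < p" "p < 1"
    and bound: "exp (- ln p * t * exp 2) \<le> (real N / k) powr \<gamma>"
  shows "measure (Q \<theta>) {\<omega> \<in> space M. dr_regular k \<gamma> 1 N (\<lambda>i. X i \<omega>) (risk_under (VaR p))}
      \<ge> 1 - 1 / (\<theta> * t)" (is "measure _ ?E \<ge> _")
proof -
  have pp: "\<theta> \<in> pareto_params" using assms by (simp add: pareto_params_def)
  interpret prob_space "Q \<theta>" by (rule prob_space_Q[OF pp])
  have [measurable]: "X i \<in> borel_measurable (Q \<theta>)" for i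
    using distributed_measurable[OF density_X[OF pp, of i]] by simp
  have sp: "space M = space (Q \<theta>)" using sets_eq_imp_space_eq[OF sets_Q[OF pp]] by simp
  define c where "c = (\<lambda>\<omega>. - ln p * (\<Sum>i=1..N. ln (X i \<omega>)) / real N)"
  have [measurable]: "c \<in> borel_measurable (Q \<theta>)" unfolding c_def by measurable
  \<comment> \<open>By \<open>interior_max_antimono\<close> this set is an interval starting at
    \<open>0\<close> if nonempty, hence Borel; that gives measurability of the event of
    regularity.\<close>
  define I where "I = {c. c \<ge> 0 \<and> interior_max k \<gamma> N c}"
  have lnp: "- ln p > 0" using assms by simp
  have "is_interval I"
    unfolding is_interval_1 I_def using interior_max_antimono[OF assms(4,5)] by force
  hence [measurable]: "I \<in> sets borel" by (rule real_interval_borel_measurable)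
  define A where "A = {\<omega> \<in> space (Q \<theta>). \<forall>i\<in>{1..N}. X i \<omega> > 1}"
  define B where "B = {\<omega> \<in> space (Q \<theta>). (\<forall>i\<in>{1..N}. X i \<omega> > 1) \<and>
      (\<Sum>i=1..N. ln (X i \<omega>)) > real N * t}"
  have [measurable]: "A \<in> sets (Q \<theta>)" unfolding A_def by measurable
  have B_sets: "B \<in> sets (Q \<theta>)" unfolding B_def by measurable
  have nonneg: "c \<omega> \<ge> 0" if "\<omega> \<in> A" for \<omega>
    unfolding c_def using lnp that
    by (intro divide_nonneg_nonneg mult_nonneg_nonneg sum_nonneg) (auto simp: A_def less_imp_le)
  have reg: "dr_regular k \<gamma> 1 N (\<lambda>i. X i \<omega>) (risk_under (VaR p)) \<longleftrightarrow> interior_max k \<gamma> N (c \<omega>)"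
    if "\<omega> \<in> A" for \<omega>
    unfolding c_def using that assms
    by (intro dr_regular_iff risk_under_VaR) (auto simp: A_def)
  have E: "?E = {\<omega> \<in> A. c \<omega> \<in> I}"
  proof (intro equalityI subsetI)
    fix \<omega> assume w: "\<omega> \<in> ?E"
    have "X i \<omega> > 1" if "i \<in> {1..N}" for i
      using not_dr_regular[OF that] w by (metis (mono_tags, lifting) mem_Collect_eq not_less)
    hence "\<omega> \<in> A" using w by (simp add: A_def sp)
    thus "\<omega> \<in> {\<omega> \<in> A. c \<omega> \<in> I}" using w reg nonneg by (simp add: I_def)
  next
    fix \<omega> assume "\<omega> \<in> {\<omega> \<in> A. c \<omega> \<in> I}"
    thus "\<omega> \<in> ?E" using reg by (simp add: I_def sp) (simp add: A_def)
  qed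
  have "{\<omega> \<in> A. c \<omega> \<in> I} = A \<inter> (c -` I \<inter> space (Q \<theta>))" by (auto simp: A_def)
  hence E_sets: "?E \<in> sets (Q \<theta>)" unfolding E by simp
  have "A \<subseteq> ?E \<union> B"
  proof
    fix \<omega> assume w: "\<omega> \<in> A"
    show "\<omega> \<in> ?E \<union> B"
    proof (cases "\<omega> \<in> B")
      case False
      hence "(\<Sum>i=1..N. ln (X i \<omega>)) \<le> real N * t" using w by (auto simp: A_def B_def)
      hence "c \<omega> \<le> - ln p * t"
        using mult_left_mono[of "\<Sum>i=1..N. ln (X i \<omega>)" "real N * t" "- ln p"] lnp assms(3)
        by (simp add: c_def field_simps)
      hence "c \<omega> * exp 2 \<le> - ln p * t * exp 2" by (intro mult_right_mono) auto
      hence "exp (c \<omega> * exp 2) \<le> (real N / k) powr \<gamma>"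
        using bound by (meson exp_le_cancel_iff order_trans)
      hence "interior_max k \<gamma> N (c \<omega>)"
        using nonneg[OF w] assms by (intro interior_max_of_exp_le) auto
      thus ?thesis using w nonneg unfolding E by (simp add: I_def)
    qed simp
  qed
  hence "prob A \<le> prob (?E \<union> B)" by (rule finite_measure_mono) (intro sets.Un E_sets B_sets)
  also have "\<dots> \<le> prob ?E + prob B" by (rule measure_Un_le) (fact E_sets B_sets)+
  finally have "prob A \<le> prob ?E + prob B" .
  moreover have "prob A = 1"
    unfolding A_def by (subst prob_Collect_eq_1)
      (auto intro!: AE_finite_allI AE_X_gt_1[OF assms(1)])
  moreover have "prob B \<le> 1 / (\<theta> * t)"
    unfolding B_def by (rule prob_sum_ln_X_gt) fact+
  ultimately show ?thesis by linarith
qed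

end

section \<open>Thresholds of logarithmic growth and the limit\<close>

theorem theorem3:
  fixes M :: "'a measure" and Q :: "real \<Rightarrow> 'a measure" and X :: "nat \<Rightarrow> 'a \<Rightarrow> real"
    and k \<gamma> :: real and \<beta> :: "nat \<Rightarrow> real"
  assumes "pareto_model M Q X"
    and "k > 0"
    and "\<gamma> \<ge> 1"
    and "\<And>N. N \<ge> 1 \<Longrightarrow> 0 < \<beta> N \<and> \<beta> N < 1"
    and "(\<lambda>N. inverse (\<beta> N)) \<in> O(\<lambda>_. 1)"
  shows "pareto_model.regularizable M Q X k \<gamma> (\<lambda>N. VaR (\<beta> N))"
proof -
  interpret pareto_model M Q X by fact
  obtain C where C: "eventually (\<lambda>N. norm (inverse (\<beta> N)) \<le> C * norm (1::real)) at_top"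
    using landau_o.bigE[OF assms(5)] by auto
  \<comment> \<open>An eventual bound for \<open>- ln (\<beta> N)\<close>; the maximum with
    \<open>1\<close> keeps it positive.\<close>
  define b where "b = max 1 (ln C)"
  \<comment> \<open>Solves \<open>b * t N * exp 2 = \<gamma> * ln (N / k)\<close>, the largest
    threshold that the hypothesis of \<open>prob_regular_ge\<close> allows when
    \<open>- ln p\<close> is replaced by its bound \<open>b\<close>.\<close>
  define t where "t = (\<lambda>N. \<gamma> * ln (real N / k) / (b * exp 2))"
  have b: "b > 0" by (simp add: b_def)
  have t_lim: "filterlim t at_top at_top"
    unfolding t_def using b assms(2,3) by real_asymp
  have ev: "eventually (\<lambda>N. N \<ge> 1 \<and> t N > 0 \<and>
      exp (- ln (\<beta> N) * t N * exp 2) \<le> (real N / k) powr \<gamma>) at_top"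
    using C eventually_ge_at_top[of 1] filterlim_at_top_dense[THEN iffD1, OF t_lim, rule_format, of 0]
  proof eventually_elim
    case (elim N)
    have be: "0 < \<beta> N" "\<beta> N < 1" using assms(4) elim by auto
    hence "1 / \<beta> N \<le> C" using elim by (simp add: field_simps)
    hence "ln (1 / \<beta> N) \<le> ln C" using be by (intro ln_mono) auto
    hence "- ln (\<beta> N) \<le> b" using be by (simp add: b_def ln_div)
    hence "- ln (\<beta> N) * (t N * exp 2) \<le> b * (t N * exp 2)"
      using elim by (intro mult_right_mono) auto
    also have "\<dots> = \<gamma> * ln (real N / k)" using b by (simp add: t_def)
    finally have "exp (- ln (\<beta> N) * t N * exp 2) \<le> exp (\<gamma> * ln (real N / k))"
      by (simp add: mult.assoc)
    also have "\<dots> = (real N / k) powr \<gamma>" using elim assms(2) by (simp add: powr_def)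
    finally show ?case using elim by simp
  qed
  show ?thesis
    unfolding regularizable_def
  proof (intro exI[of _ 1] conjI ballI)
    fix \<theta>\<^sub>0 assume "\<theta>\<^sub>0 \<in> pareto_params"
    hence pos: "\<theta>\<^sub>0 > 0" by (simp add: pareto_params_def)
    interpret P: prob_space "Q \<theta>\<^sub>0" by (rule prob_space_Q) fact
    show "(\<lambda>N. measure (Q \<theta>\<^sub>0)
        {\<omega> \<in> space M. dr_regular k \<gamma> 1 N (\<lambda>i. X i \<omega>) (risk_under (VaR (\<beta> N)))}) \<longlonglongrightarrow> 1"
    proof (rule tendsto_sandwich)
      show "\<forall>\<^sub>F N in sequentially. 1 - 1 / (\<theta>\<^sub>0 * t N) \<le> measure (Q \<theta>\<^sub>0)
          {\<omega> \<in> space M. dr_regular k \<gamma> 1 N (\<lambda>i. X i \<omega>) (risk_under (VaR (\<beta> N)))}"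
        using ev by eventually_elim (rule prob_regular_ge, use pos assms(2-4) in auto)
      have "filterlim (\<lambda>N. \<theta>\<^sub>0 * t N) at_top at_top"
        using filterlim_tendsto_pos_mult_at_top[OF tendsto_const pos t_lim] .
      hence "(\<lambda>N. 1 / (\<theta>\<^sub>0 * t N)) \<longlonglongrightarrow> 0"
        by (intro real_tendsto_divide_at_top) auto
      thus "(\<lambda>N. 1 - 1 / (\<theta>\<^sub>0 * t N)) \<longlonglongrightarrow> 1"
        using tendsto_diff[OF tendsto_const[of 1]] by fastforce
    qed auto
  qed simp
qed

end
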